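(* Let $T_I(F)$ and $T_{FD}(F)$ be parameters defined for all joint cdfs $F$ of real pairs $(X,Y)$ with $Y$ not constant, with associated statistics $\hat T_I,\hat T_{FD}$ based on an i.i.d. sample of size $n$ from $F$, such that: - $0\le T_I(F)\le1$; $T_I(F)=0$ if and only if $X$ and $Y$ are independent; $T_I(F)<1$ for all $F$; and $\hat T_I$ is consistent for $T_I(F)$ whatever be $F$; - $0\le T_{FD}(F)\le1$; $T_{FD}(F)=1$ if and only if $Y=h(X)$ a.s. for some $h$; $T_{FD}(F)=0$ if $X$ and $Y$ are independent; and $\hat T_{FD}$ is consistent for $T_{FD}(F)$. Let $$D(F)=\begin{cases}T_I(F)&\text{if }0\le T_{FD}(F)\le\frac12,\\ T_{FD}(F)&\text{otherwise,}\end{cases}$$ and let $\hat D$ be similarly defined in terms of $\hat T_I$ and $\hat T_{FD}$, i.e. $\hat D=\hat T_I$ if $0\le\hat T_{FD}\le\frac12$ and $\hat D=\hat T_{FD}$ otherwise. (Here $\frac12$ may be replaced by any number $<1$.) Then: (i) $P_0[\hat D=\hat T_I]\to1$, where $P_0$ denotes probability when $X$ and $Y$ are independent; (ii) $\hat D\to0$ in probability implies that $X$ and $Y$ are independent; (iii) $\hat D\to1$ in probability if and only if $Y=h(X)$ a.s. for some $h$.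
   Context: All limits are as the sample size $n\to\infty$, with $(X_1,Y_1),\dots,(X_n,Y_n)$ i.i.d. from $F$. Consistency of a statistic for a parameter means convergence in probability to it under $F$. $T_I$ plays the role of a measure of dependence and $T_{FD}$ that of a measure of functional dependence of $Y$ on $X$.
   Formalization: The formal theorem additionally assumes that the statistic for T_FD is nonnegative on every sample, and takes the threshold strictly between 0 and 1 rather than any number < 1; without these, (i) can fail, e.g. for a consistent statistic that is negative under independence. *)

theory Defs
  imports "HOL-Probability.Probability"
begin

text \<open>
  A pair \<open>(X, Y)\<close> is modelled on its canonical space: a law \<open>P\<close> on the plane with
  \<open>X = fst\<close> and \<open>Y = snd\<close>. Parameters are functions of the joint cdf of \<open>P\<close>.
\<close>

definition joint_cdf :: "(real \<times> real) measure \<Rightarrow> real \<Rightarrow> real \<Rightarrow> real" where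
  "joint_cdf P x y = measure P {z. fst z \<le> x \<and> snd z \<le> y}"

definition nonconst_pair_law :: "(real \<times> real) measure \<Rightarrow> bool" where
  "nonconst_pair_law P \<longleftrightarrow>
     prob_space P \<and> sets P = sets borel \<and> \<not> (\<exists>c. AE z in P. snd z = c)"

definition independent_pair :: "(real \<times> real) measure \<Rightarrow> bool" where
  "independent_pair P \<longleftrightarrow> prob_space.indep_var P borel fst borel snd"

definition functionally_dependent :: "(real \<times> real) measure \<Rightarrow> bool" where
  "functionally_dependent P \<longleftrightarrow>
     (\<exists>h \<in> borel_measurable borel. AE z in P. snd z = h (fst z))"

text \<open>
  The i.i.d. sequence is the coordinate process of the infinite product. Its entry \<open>\<omega> i\<close>
  is the pair usually numbered \<open>i + 1\<close>.
\<close>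

definition sample_space :: "(real \<times> real) measure \<Rightarrow> (nat \<Rightarrow> real \<times> real) measure" where
  "sample_space P = PiM UNIV (\<lambda>_. P)"

definition is_statistic :: "(nat \<Rightarrow> (nat \<Rightarrow> real \<times> real) \<Rightarrow> real) \<Rightarrow> bool" where
  "is_statistic T \<longleftrightarrow> (\<forall>n. T n \<in> borel_measurable (PiM {..<n} (\<lambda>_. borel)))"

text \<open>The statistic \<open>T n\<close> evaluated at the first \<open>n\<close> observations.\<close>

definition on_sample ::
    "(nat \<Rightarrow> (nat \<Rightarrow> real \<times> real) \<Rightarrow> real) \<Rightarrow> nat \<Rightarrow> (nat \<Rightarrow> real \<times> real) \<Rightarrow> real" where
  "on_sample T n \<omega> = T n (restrict \<omega> {..<n})"

definition converges_in_prob :: "'w measure \<Rightarrow> (nat \<Rightarrow> 'w \<Rightarrow> real) \<Rightarrow> real \<Rightarrow> bool" where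
  "converges_in_prob M Z z \<longleftrightarrow>
     (\<forall>\<epsilon>>0. (\<lambda>n. measure M {\<omega> \<in> space M. \<bar>Z n \<omega> - z\<bar> > \<epsilon>}) \<longlonglongrightarrow> 0)"

definition consistent ::
    "(nat \<Rightarrow> (nat \<Rightarrow> real \<times> real) \<Rightarrow> real) \<Rightarrow> ((real \<Rightarrow> real \<Rightarrow> real) \<Rightarrow> real)
       \<Rightarrow> (real \<times> real) measure \<Rightarrow> bool" where
  "consistent T' T P \<longleftrightarrow> converges_in_prob (sample_space P) (on_sample T') (T (joint_cdf P))"

text \<open>
  The switching rule with threshold \<open>c\<close>. It is polymorphic so that it serves both the parameters,
  with \<open>D = switched c T\<^sub>I T\<^sub>F\<^sub>D\<close> a function of the joint cdf, and the
  statistics for each sample size, as functions of the sample.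
\<close>

definition switched :: "real \<Rightarrow> ('a \<Rightarrow> real) \<Rightarrow> ('a \<Rightarrow> real) \<Rightarrow> 'a \<Rightarrow> real" where
  "switched c TI TFD a = (if 0 \<le> TFD a \<and> TFD a \<le> c then TI a else TFD a)"

end

theory Submission imports Defs
begin

text \<open>
  With probability tending to one, both statistics are close to their parameters, and \<open>hD\<close> equals
  one of them: \<open>hT_I\<close> when \<open>hT_FD \<le> c\<close>, and \<open>hT_FD\<close> otherwise. Since \<open>hT_FD > c > 0\<close> on the
  second branch, \<open>hD\<close> can only be near \<open>0\<close> through \<open>hT_I\<close>; since \<open>T_I < 1\<close>, it can only be near \<open>1\<close>
  through \<open>hT_FD\<close>. This holds even if \<open>T_FD = c\<close>, where \<open>hD\<close> may switch forever.
\<close>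

lemma prob_space_sample_space:
  assumes "prob_space P"
  shows "prob_space (sample_space P)"
  unfolding sample_space_def by (rule prob_space_PiM) (rule assms)

text \<open>Every factor has full space, and \<open>restrict\<close> is \<open>undefined\<close> off
  \<open>{..<n}\<close>, as extensionality demands. So hypotheses stated on the finite product apply
  at every \<omega>.\<close>

lemma restrict_sample_in_space:
  "restrict \<omega> {..<n} \<in> space (PiM {..<n} (\<lambda>_. borel))"
  by (simp add: space_PiM)

lemma measurable_on_sample:
  assumes "is_statistic T" and P: "sets P = sets borel"
  shows "on_sample T n \<in> borel_measurable (sample_space P)"
proof -
  \<comment> \<open>\<open>is_statistic\<close> speaks of Borel factors, \<open>sample_space\<close>
    of factors \<open>P\<close>; measurability depends only on the sigma-algebras, and these
    agree.\<close>
  have T: "T n \<in> borel_measurable (PiM {..<n} (\<lambda>_. P))"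
    using assms(1) unfolding is_statistic_def
    by (simp add: measurable_cong_sets[OF sets_PiM_cong[OF refl P] refl])
  show ?thesis
    unfolding on_sample_def sample_space_def
    by (rule measurable_compose[OF _ T]) (rule measurable_restrict_subset, simp)
qed

lemma is_statistic_switched:
  assumes "is_statistic T" and "is_statistic S"
  shows "is_statistic (\<lambda>n. switched c (T n) (S n))"
  unfolding is_statistic_def
proof
  fix n
  have [measurable]: "T n \<in> borel_measurable (PiM {..<n} (\<lambda>_. borel))"
    "S n \<in> borel_measurable (PiM {..<n} (\<lambda>_. borel))"
    using assms by (auto simp: is_statistic_def)
  show "switched c (T n) (S n) \<in> borel_measurable (PiM {..<n} (\<lambda>_. borel))"
    unfolding switched_def[abs_def] by measurable
qed

text \<open>Nonnegativity of \<open>S\<close> makes the test \<open>0 \<le> S\<close> vacuous, which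
  leaves a two-way split at \<open>c\<close>, valid pointwise in \<omega>.\<close>

lemma on_sample_switched:
  assumes "\<And>n s. s \<in> space (PiM {..<n} (\<lambda>_. borel)) \<Longrightarrow> 0 \<le> S n s"
  shows "on_sample (\<lambda>n. switched c (T n) (S n)) n \<omega> =
    (if on_sample S n \<omega> \<le> c then on_sample T n \<omega> else on_sample S n \<omega>)"
  using assms[OF restrict_sample_in_space] by (simp add: on_sample_def switched_def)

text \<open>The three exceptional events have total probability tending to 0, so for some
  \<open>n\<close> they cannot cover the space. One sample outside them turns three limits into
  numerical inequalities, ready for a contradiction.\<close>

lemma converges_in_prob_joint_witness:
  assumes M: "prob_space M"
    and meas: "\<And>n. U n \<in> borel_measurable M" "\<And>n. V n \<in> borel_measurable M"
      "\<And>n. W n \<in> borel_measurable M"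
    and conv: "converges_in_prob M U u" "converges_in_prob M V v" "converges_in_prob M W w"
    and e: "0 < e"
  obtains n \<omega> where "\<bar>U n \<omega> - u\<bar> \<le> e" "\<bar>V n \<omega> - v\<bar> \<le> e" "\<bar>W n \<omega> - w\<bar> \<le> e"
proof -
  interpret prob_space M by fact
  note meas[measurable]
  define bad where "bad Z z n = {\<omega> \<in> space M. \<bar>Z n \<omega> - z\<bar> > e}"
    for Z :: "nat \<Rightarrow> 'a \<Rightarrow> real" and z n
  have "(\<lambda>n. prob (bad U u n) + prob (bad V v n) + prob (bad W w n)) \<longlonglongrightarrow> 0 + 0 + 0"
    using conv e unfolding converges_in_prob_def bad_def by (intro tendsto_add) auto
  \<comment> \<open>Any bound up to 1, the mass of the whole space, would do here.\<close>
  then have "\<forall>\<^sub>F n in sequentially. prob (bad U u n) + prob (bad V v n) + prob (bad W w n) < 1"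
    by (rule order_tendstoD) simp
  then obtain n where n: "prob (bad U u n) + prob (bad V v n) + prob (bad W w n) < 1"
    by (auto simp: eventually_sequentially)
  have sets: "bad U u n \<in> events" "bad V v n \<in> events" "bad W w n \<in> events"
    unfolding bad_def by measurable
  have "prob (bad U u n \<union> bad V v n \<union> bad W w n)
      \<le> prob (bad U u n \<union> bad V v n) + prob (bad W w n)"
    using sets by (intro measure_Un_le) auto
  also have "\<dots> \<le> prob (bad U u n) + prob (bad V v n) + prob (bad W w n)"
    using sets measure_Un_le[of "bad U u n" M "bad V v n"] by simp
  finally have "bad U u n \<union> bad V v n \<union> bad W w n \<noteq> space M"
    using n prob_space by auto
  then obtain \<omega> where "\<omega> \<in> space M" "\<omega> \<notin> bad U u n" "\<omega> \<notin> bad V v n" "\<omega> \<notin> bad W w n"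
    unfolding bad_def by blast
  then show thesis by (intro that[of n \<omega>]) (auto simp: bad_def)
qed

text \<open>If \<open>W n\<close> misses \<open>v\<close> by more than \<open>e\<close>, then either
  \<open>V n\<close> misses it by more than \<open>d\<close>, or the two agree and
  \<open>V n\<close> misses it by more than \<open>e\<close>. Both cases lie in the event that
  \<open>V n\<close> misses \<open>v\<close> by more than \<open>min d e\<close>.\<close>

lemma converges_in_prob_eventually_eq:
  assumes M: "prob_space M"
    and meas: "\<And>n. V n \<in> borel_measurable M"
    and conv: "converges_in_prob M V v"
    and d: "0 < d"
    and eq: "\<And>n \<omega>. \<omega> \<in> space M \<Longrightarrow> \<bar>V n \<omega> - v\<bar> \<le> d \<Longrightarrow> W n \<omega> = V n \<omega>"
  shows "converges_in_prob M W v"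
  unfolding converges_in_prob_def
proof (intro allI impI)
  interpret prob_space M by fact
  note meas[measurable]
  fix e :: real assume e: "0 < e"
  have lim: "(\<lambda>n. prob {\<omega> \<in> space M. \<bar>V n \<omega> - v\<bar> > min d e}) \<longlonglongrightarrow> 0"
    using conv d e unfolding converges_in_prob_def by simp
  have bound: "prob {\<omega> \<in> space M. \<bar>W n \<omega> - v\<bar> > e}
      \<le> prob {\<omega> \<in> space M. \<bar>V n \<omega> - v\<bar> > min d e}" for n
  proof (rule finite_measure_mono)
    show "{\<omega> \<in> space M. \<bar>W n \<omega> - v\<bar> > e} \<subseteq> {\<omega> \<in> space M. \<bar>V n \<omega> - v\<bar> > min d e}"
      using eq[of _ n] by fastforce
  qed measurable
  show "(\<lambda>n. prob {\<omega> \<in> space M. \<bar>W n \<omega> - v\<bar> > e}) \<longlonglongrightarrow> 0"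
    by (rule Lim_null_comparison[OF always_eventually lim]) (use bound in simp)
qed

text \<open>The event \<open>Q n\<close> contains the complement of a deviation event whose
  probability vanishes, so its probability is squeezed between a sequence tending to 1 and 1
  itself.\<close>

lemma converges_in_prob_implies_prob_tendsto_1:
  assumes M: "prob_space M"
    and meas: "\<And>n. V n \<in> borel_measurable M"
    and conv: "converges_in_prob M V v"
    and d: "0 < d"
    and Q: "\<And>n. {\<omega> \<in> space M. Q n \<omega>} \<in> sets M"
    and imp: "\<And>n \<omega>. \<omega> \<in> space M \<Longrightarrow> \<bar>V n \<omega> - v\<bar> \<le> d \<Longrightarrow> Q n \<omega>"
  shows "(\<lambda>n. measure M {\<omega> \<in> space M. Q n \<omega>}) \<longlonglongrightarrow> 1"
proof -
  interpret prob_space M by fact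
  note meas[measurable]
  have "(\<lambda>n. prob {\<omega> \<in> space M. \<bar>V n \<omega> - v\<bar> > d}) \<longlonglongrightarrow> 0"
    using conv d unfolding converges_in_prob_def by simp
  from tendsto_diff[OF tendsto_const[of 1] this]
  have lim: "(\<lambda>n. 1 - prob {\<omega> \<in> space M. \<bar>V n \<omega> - v\<bar> > d}) \<longlonglongrightarrow> 1"
    by simp
  have "1 - prob {\<omega> \<in> space M. \<bar>V n \<omega> - v\<bar> > d} \<le> prob {\<omega> \<in> space M. Q n \<omega>}" for n
  proof -
    have "1 - prob {\<omega> \<in> space M. \<bar>V n \<omega> - v\<bar> > d}
        = prob (space M - {\<omega> \<in> space M. \<bar>V n \<omega> - v\<bar> > d})"
      by (rule prob_compl[symmetric]) measurable
    also have "\<dots> \<le> prob {\<omega> \<in> space M. Q n \<omega>}"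
      using imp by (intro finite_measure_mono Q) (auto simp: not_less)
    finally show ?thesis .
  qed
  then show ?thesis
    by (intro tendsto_sandwich[OF _ _ lim tendsto_const]) auto
qed

theorem mainTheorem6:
  fixes T_I T_FD :: "(real \<Rightarrow> real \<Rightarrow> real) \<Rightarrow> real"
    and hT_I hT_FD hD :: "nat \<Rightarrow> (nat \<Rightarrow> real \<times> real) \<Rightarrow> real"
    and D :: "(real \<Rightarrow> real \<Rightarrow> real) \<Rightarrow> real"
    and c :: real
  assumes stat_I: "is_statistic hT_I"
    and stat_FD: "is_statistic hT_FD"
    and I_range: "\<And>P. nonconst_pair_law P \<Longrightarrow> 0 \<le> T_I (joint_cdf P) \<and> T_I (joint_cdf P) \<le> 1"
    and I_zero: "\<And>P. nonconst_pair_law P \<Longrightarrow> T_I (joint_cdf P) = 0 \<longleftrightarrow> independent_pair P"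
    and I_less: "\<And>P. nonconst_pair_law P \<Longrightarrow> T_I (joint_cdf P) < 1"
    and I_consistent: "\<And>P. nonconst_pair_law P \<Longrightarrow> consistent hT_I T_I P"
    and FD_range: "\<And>P. nonconst_pair_law P \<Longrightarrow> 0 \<le> T_FD (joint_cdf P) \<and> T_FD (joint_cdf P) \<le> 1"
    and FD_one: "\<And>P. nonconst_pair_law P \<Longrightarrow> T_FD (joint_cdf P) = 1 \<longleftrightarrow> functionally_dependent P"
    and FD_zero: "\<And>P. nonconst_pair_law P \<Longrightarrow> independent_pair P \<Longrightarrow> T_FD (joint_cdf P) = 0"
    and FD_consistent: "\<And>P. nonconst_pair_law P \<Longrightarrow> consistent hT_FD T_FD P"
    and FD_stat_nonneg: "\<And>n s. s \<in> space (PiM {..<n} (\<lambda>_. borel)) \<Longrightarrow> 0 \<le> hT_FD n s"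
    and c: "0 < c" "c < 1"
    and D: "D = switched c T_I T_FD"
    and hD: "\<And>n. hD n = switched c (hT_I n) (hT_FD n)"
  shows
    "(\<forall>P. nonconst_pair_law P \<and> independent_pair P \<longrightarrow>
        (\<lambda>n. measure (sample_space P)
               {\<omega> \<in> space (sample_space P). on_sample hD n \<omega> = on_sample hT_I n \<omega>}) \<longlonglongrightarrow> 1)
   \<and> (\<forall>P. nonconst_pair_law P \<longrightarrow>
        converges_in_prob (sample_space P) (on_sample hD) 0 \<longrightarrow> independent_pair P)
   \<and> (\<forall>P. nonconst_pair_law P \<longrightarrow>
        (converges_in_prob (sample_space P) (on_sample hD) 1 \<longleftrightarrow> functionally_dependent P))"
proof -
  have hD_eq: "hD = (\<lambda>n. switched c (hT_I n) (hT_FD n))"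
    using hD by blast
  have branch: "on_sample hD n \<omega> =
      (if on_sample hT_FD n \<omega> \<le> c then on_sample hT_I n \<omega> else on_sample hT_FD n \<omega>)" for n \<omega>
    unfolding hD_eq using FD_stat_nonneg by (rule on_sample_switched)
  have stat_D: "is_statistic hD"
    unfolding hD_eq using stat_I stat_FD by (rule is_statistic_switched)
  have prob: "prob_space (sample_space P)" if "nonconst_pair_law P" for P
    using that unfolding nonconst_pair_law_def by (auto intro: prob_space_sample_space)
  have meas: "on_sample T n \<in> borel_measurable (sample_space P)"
    if "nonconst_pair_law P" "is_statistic T" for P T n
    using that unfolding nonconst_pair_law_def by (auto intro: measurable_on_sample)
  have conv_I: "converges_in_prob (sample_space P) (on_sample hT_I) (T_I (joint_cdf P))"
    if "nonconst_pair_law P" for P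
    using I_consistent[OF that] by (simp add: consistent_def)
  have conv_FD: "converges_in_prob (sample_space P) (on_sample hT_FD) (T_FD (joint_cdf P))"
    if "nonconst_pair_law P" for P
    using FD_consistent[OF that] by (simp add: consistent_def)

  \<comment> \<open>Under independence \<open>hT_FD\<close> converges to 0. The closed ball of
    radius \<open>c\<close> suffices, because the boundary value \<open>c\<close> still selects
    \<open>hT_I\<close>.\<close>
  have "(\<lambda>n. measure (sample_space P)
      {\<omega> \<in> space (sample_space P). on_sample hD n \<omega> = on_sample hT_I n \<omega>}) \<longlonglongrightarrow> 1"
    if P: "nonconst_pair_law P" and ind: "independent_pair P" for P
  proof (rule converges_in_prob_implies_prob_tendsto_1[OF prob[OF P] meas[OF P stat_FD]
        conv_FD[OF P] c(1)])
    note [measurable] = meas[OF P stat_I] meas[OF P stat_D]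
    show "{\<omega> \<in> space (sample_space P). on_sample hD n \<omega> = on_sample hT_I n \<omega>}
        \<in> sets (sample_space P)" for n
      by measurable
  qed (use FD_zero[OF P ind] branch in auto)

  moreover have "independent_pair P"
    if P: "nonconst_pair_law P" and D0: "converges_in_prob (sample_space P) (on_sample hD) 0" for P
  proof (rule ccontr)
    assume "\<not> independent_pair P"
    then have pos: "0 < T_I (joint_cdf P)"
      using I_zero[OF P] I_range[OF P] by auto
    \<comment> \<open>Both branches fail at the witness: the first gives
      \<open>hD \<ge> T_I - e > e\<close>, the second \<open>hD > c > e\<close>, against
      \<open>\<bar>hD\<bar> \<le> e\<close>.\<close>
    define e where "e = min c (T_I (joint_cdf P)) / 3"
    have "0 < e" "e < c" "2 * e < T_I (joint_cdf P)"
      using pos c by (auto simp: e_def min_def)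
    moreover obtain n \<omega> where
      "\<bar>on_sample hT_I n \<omega> - T_I (joint_cdf P)\<bar> \<le> e"
      "\<bar>on_sample hT_FD n \<omega> - T_FD (joint_cdf P)\<bar> \<le> e" "\<bar>on_sample hD n \<omega> - 0\<bar> \<le> e"
      using converges_in_prob_joint_witness[OF prob[OF P] meas[OF P stat_I] meas[OF P stat_FD]
          meas[OF P stat_D] conv_I[OF P] conv_FD[OF P] D0 \<open>0 < e\<close>] .
    ultimately show False
      using branch[of n \<omega>] by (auto split: if_splits)
  qed

  moreover have "functionally_dependent P"
    if P: "nonconst_pair_law P" and D1: "converges_in_prob (sample_space P) (on_sample hD) 1" for P
  proof (rule ccontr)
    assume "\<not> functionally_dependent P"
    then have less: "T_FD (joint_cdf P) < 1"
      using FD_one[OF P] FD_range[OF P] by auto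
    \<comment> \<open>In either branch \<open>hD\<close> is within \<open>e\<close> of
      \<open>T_I\<close> or of \<open>T_FD\<close>. Being also within \<open>e\<close> of 1, it
      would put that parameter within \<open>2 * e\<close> of 1, but both gaps exceed
      \<open>2 * e\<close>.\<close>
    define e where "e = min (1 - T_I (joint_cdf P)) (1 - T_FD (joint_cdf P)) / 3"
    have "0 < e" "2 * e < 1 - T_I (joint_cdf P)" "2 * e < 1 - T_FD (joint_cdf P)"
      using less I_less[OF P] by (auto simp: e_def min_def)
    moreover obtain n \<omega> where
      "\<bar>on_sample hT_I n \<omega> - T_I (joint_cdf P)\<bar> \<le> e"
      "\<bar>on_sample hT_FD n \<omega> - T_FD (joint_cdf P)\<bar> \<le> e" "\<bar>on_sample hD n \<omega> - 1\<bar> \<le> e"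
      using converges_in_prob_joint_witness[OF prob[OF P] meas[OF P stat_I] meas[OF P stat_FD]
          meas[OF P stat_D] conv_I[OF P] conv_FD[OF P] D1 \<open>0 < e\<close>] .
    ultimately show False
      using branch[of n \<omega>] by (auto split: if_splits)
  qed

  moreover have "converges_in_prob (sample_space P) (on_sample hD) 1"
    if P: "nonconst_pair_law P" and fd: "functionally_dependent P" for P
  proof (rule converges_in_prob_eventually_eq[OF prob[OF P] meas[OF P stat_FD]])
    show "converges_in_prob (sample_space P) (on_sample hT_FD) 1"
      using conv_FD[OF P] FD_one[OF P] fd by simp
    \<comment> \<open>Within this distance of 1, \<open>hT_FD \<ge> (1 + c) / 2 > c\<close>, so
      \<open>hD\<close> takes the second branch. The full radius \<open>1 - c\<close> would admit
      the value \<open>c\<close>, which selects \<open>hT_I\<close>.\<close>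
    show "0 < (1 - c) / 2"
      using c by simp
    show "on_sample hD n \<omega> = on_sample hT_FD n \<omega>"
      if "\<bar>on_sample hT_FD n \<omega> - 1\<bar> \<le> (1 - c) / 2" for n \<omega>
      using that c branch[of n \<omega>] by (auto simp: abs_le_iff field_simps)
  qed

  ultimately show ?thesis by blast
qed

end
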